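(* Let $n \ge 1$, let $\theta^* \in \mathbb{R}^n$ be arbitrary, and let $Y = \theta^* + \varepsilon$ where $\varepsilon = (\varepsilon_1, \dots, \varepsilon_n)$ has i.i.d. components with mean zero and (finite) variance $\sigma^2$. Let $\hat\theta$ be the isotonic least squares estimator, i.e. the projection of $Y$ onto $\mathcal{I} = \{\theta \in \mathbb{R}^n : \theta_1 \le \dots \le \theta_n\}$. Then, for every $\theta^* \in \mathbb{R}^n$, $$R(\hat\theta, \theta^* ) \le \inf_{\theta \in \mathcal{I}} \left[ \frac{1}{n}\|\theta^* - \theta\|^2 + \frac{4\sigma^2 k(\theta)}{n} \log\frac{en}{k(\theta)} \right].$$
   Context: $\|\cdot\|$ is the Euclidean norm on $\mathbb{R}^n$. $\mathcal{I} := \{(\theta_1,\dots,\theta_n) \in \mathbb{R}^n : \theta_1 \le \dots \le \theta_n\}$ is a closed convex cone, and the isotonic least squares estimator is $\hat\theta := \arg\min_{\theta \in \mathcal{I}} \|Y - \theta\|^2$ (it exists and is unique). The risk is $R(\hat\theta,\theta^* ) := \frac{1}{n}\mathbb{E}\big[\|\hat\theta - \theta^*\|^2\big]$, the expectation being over $\varepsilon$. For $\theta \in \mathcal{I}$, $k(\theta) \ge 1$ denotes the number of constant blocks of $\theta$: $k(\theta) - 1$ is the number of indices $i \in \{1,\dots,n-1\}$ with $\theta_i < \theta_{i+1}$. Here $e$ is Euler's number and $\log$ is the natural logarithm. *)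

theory Defs
  imports "HOL-Probability.Probability"
begin

text \<open>
  The coordinates of $\mathbb{R}^n$ are indexed by an arbitrary finite linearly ordered type
  with $n$ elements. Such a type is order isomorphic to $1 < \dots < n$, and $n \ge 1$ holds
  because types are non-empty. Conversely, every $n \ge 1$ is the cardinality of such a type.
\<close>

definition isotonic_cone :: "(real ^ 'n::{finite,linorder}) set" where
  "isotonic_cone = {\<theta>. \<forall>i j. i \<le> j \<longrightarrow> \<theta> $ i \<le> \<theta> $ j}"

definition isotonic_lse :: "real ^ 'n::{finite,linorder} \<Rightarrow> real ^ 'n::{finite,linorder}" where
  "isotonic_lse Y = arg_min_on (\<lambda>\<theta>. (norm (Y - \<theta>))\<^sup>2) isotonic_cone"

definition next_index :: "'n::{finite,linorder} \<Rightarrow> 'n \<Rightarrow> bool" where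
  "next_index i j \<longleftrightarrow> i < j \<and> (\<forall>l. \<not> (i < l \<and> l < j))"

text \<open>
  An index has at most one immediate successor (none if it is the last one), so the set below
  is the set of those \<open>i\<close> among the first $n - 1$ indices at which \<open>\<theta>\<close> jumps upwards.
\<close>

definition num_blocks :: "real ^ 'n::{finite,linorder} \<Rightarrow> nat" where
  "num_blocks \<theta> = card {i. \<exists>j. next_index i j \<and> \<theta> $ i < \<theta> $ j} + 1"

definition (in prob_space) risk :: "('a \<Rightarrow> real ^ 'n::finite) \<Rightarrow> real ^ 'n::finite \<Rightarrow> real" where
  "risk \<theta>hat \<theta>star =
     1 / real CARD('n) * expectation (\<lambda>\<omega>. (norm (\<theta>hat \<omega> - \<theta>star))\<^sup>2)"

lemma convex_isotonic_cone: "convex isotonic_cone"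
  by (auto simp: convex_def isotonic_cone_def intro!: add_mono mult_left_mono)

lemma closed_isotonic_cone: "closed (isotonic_cone :: (real ^ 'n::{finite,linorder}) set)"
proof -
  have "closed {\<theta> :: real ^ 'n::{finite,linorder}. \<theta> $ i \<le> \<theta> $ j}" for i j
    by (intro closed_Collect_le continuous_intros)
  then show ?thesis
    unfolding isotonic_cone_def
    by (intro closed_Collect_all) (simp add: closed_Collect_const Collect_imp_eq closed_Un open_Collect_const)
qed

lemma zero_in_isotonic_cone: "0 \<in> isotonic_cone"
  by (simp add: isotonic_cone_def)

lemma isotonic_lse_eq_closest_point: "isotonic_lse Y = closest_point isotonic_cone Y"
  unfolding isotonic_lse_def arg_min_on_def arg_min_def closest_point_def is_arg_min_def
  by (rule arg_cong[where f = Eps]) (auto simp: fun_eq_iff dist_norm not_less)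

lemma isotonic_lse_minimal:
  "isotonic_lse Y \<in> isotonic_cone"
  "\<theta> \<in> isotonic_cone \<Longrightarrow> norm (Y - isotonic_lse Y) \<le> norm (Y - \<theta>)"
  using closest_point_exists[OF closed_isotonic_cone, of Y] zero_in_isotonic_cone
  by (auto simp: isotonic_lse_eq_closest_point dist_norm)

lemma isotonic_lse_unique:
  assumes "x \<in> isotonic_cone" "\<And>\<theta>. \<theta> \<in> isotonic_cone \<Longrightarrow> norm (Y - x) \<le> norm (Y - \<theta>)"
  shows "x = isotonic_lse Y"
  unfolding isotonic_lse_eq_closest_point
  using assms convex_isotonic_cone closed_isotonic_cone
  by (intro closest_point_unique) (auto simp: dist_norm)

end

theory Submission
  imports Defs
begin

text \<open>
  Let \<open>\<theta>\<close> be isotonic and let \<open>t\<close> be the difference of the estimator and \<open>\<theta>\<close>.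
  The variational inequality for the projection bounds the squared error by
  $\|\theta^* - \theta\|^2 + 2 \langle \varepsilon, t \rangle - \|t\|^2$, and \<open>t\<close> is
  non-decreasing on each level set of \<open>\<theta>\<close>. On a level set with \<open>m\<close> elements, the
  positive and the negative part of \<open>t\<close> are monotone and non-negative, and summation by parts
  bounds their contributions by sums of squared running maxima of one-sided averages of the noise.
  These averages form a reversed martingale, so Doob's $L^2$ inequality gives the expected bound
  $4 \sigma^2 (1 + 1/2 + \dots + 1/m) \le 4 \sigma^2 \log (e m)$. Concavity of the logarithm
  then sums these bounds over the \<open>k(\<theta>)\<close> level sets.
\<close>

section \<open>Running maxima and the pathwise form of Doob's inequality\<close>

primrec run_max :: "(nat \<Rightarrow> real) \<Rightarrow> nat \<Rightarrow> real" where
  "run_max x 0 = x 0"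
| "run_max x (Suc d) = max (run_max x d) (x (Suc d))"

lemma run_max_ge: "e \<le> d \<Longrightarrow> x e \<le> run_max x d"
  by (induction d) (auto simp: le_Suc_eq)

lemma run_max_cong: "(\<And>e. e \<le> d \<Longrightarrow> x e = y e) \<Longrightarrow> run_max x d = run_max y d"
  by (induction d) auto

text \<open>
  Doob's $L^2$ inequality in pathwise form: the sum on the right is a martingale transform with
  non-negative integrand.
\<close>

lemma pathwise_doob:
  fixes x :: "nat \<Rightarrow> real"
  assumes "\<And>e. x e \<ge> 0"
  shows "(run_max x d)\<^sup>2 \<le> 4 * (x d)\<^sup>2 - 4 * (\<Sum>e<d. run_max x e * (x (Suc e) - x e))"
proof -
  \<comment> \<open>This version, linear in the last entry, is the one that survives induction: one
    step loses only the square of the rise of the maximum. The square of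
    \<open>run_max x d - 2 * x d\<close> then absorbs the mixed term and produces the constant
    4.\<close>
  have "(run_max x d)\<^sup>2 \<le> 2 * run_max x d * x d - 2 * (\<Sum>e<d. run_max x e * (x (Suc e) - x e))"
  proof (induction d)
    case 0
    show ?case by (simp add: power2_eq_square)
  next
    case (Suc d)
    define a where "a = run_max x d"
    define b where "b = x (Suc d)"
    have "(max a b)\<^sup>2 \<le> 2 * (max a b - a) * b + a\<^sup>2"
    proof (cases "a \<le> b")
      case True
      have "0 \<le> (b - a)\<^sup>2" by simp
      with True show ?thesis by (simp add: max_def power2_eq_square algebra_simps)
    qed (simp add: max_def)
    with Suc show ?case by (simp add: a_def b_def algebra_simps)
  qed
  moreover have "0 \<le> (run_max x d - 2 * x d)\<^sup>2" by simp
  ultimately show ?thesis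
    by (simp add: power2_eq_square algebra_simps)
qed

section \<open>Prefix means and the deterministic bound for monotone sequences\<close>

definition prefix_mean :: "(nat \<Rightarrow> real) \<Rightarrow> nat \<Rightarrow> real" where
  "prefix_mean x r = (\<Sum>j<r. x j) / real r"

text \<open>
  Prefix lengths run downwards from \<open>m\<close>: for exchangeable entries the prefix means
  form a martingale in this (reversed) order.
\<close>

definition tail_max :: "nat \<Rightarrow> (nat \<Rightarrow> real) \<Rightarrow> nat \<Rightarrow> real" where
  "tail_max m x d = run_max (\<lambda>e. max 0 (prefix_mean x (m - e))) d"

lemma prefix_mean_cong:
  "(\<And>j. j < r \<Longrightarrow> x j = y j) \<Longrightarrow> prefix_mean x r = prefix_mean y r"
  by (simp add: prefix_mean_def)

text \<open>Phrased through prefix means instead of entries, because permuting the first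
  \<open>m - d\<close> entries changes the entries but none of the means that enter the
  maximum.\<close>

lemma tail_max_cong:
  "(\<And>e. e \<le> d \<Longrightarrow> prefix_mean x (m - e) = prefix_mean y (m - e)) \<Longrightarrow> tail_max m x d = tail_max m y d"
  by (auto simp: tail_max_def intro!: run_max_cong)

lemma tail_max_nonneg: "0 \<le> tail_max m x d"
  unfolding tail_max_def by (induction d) auto

text \<open>Abel summation by induction: a prefix sum is non-negative, so lowering its weight from
  \<open>s m\<close> to \<open>s (Suc m)\<close> can only decrease the product. The length
  \<open>Suc m\<close> guarantees that a last weight exists.\<close>

lemma sum_antimono_weights_ge:
  fixes c s :: "nat \<Rightarrow> real"
  assumes "\<And>r. r \<le> Suc m \<Longrightarrow> 0 \<le> (\<Sum>j<r. c j)"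
    and "\<And>j k. j \<le> k \<Longrightarrow> k < Suc m \<Longrightarrow> s k \<le> s j"
  shows "s m * (\<Sum>j<Suc m. c j) \<le> (\<Sum>j<Suc m. c j * s j)"
  using assms
proof (induction m)
  case (Suc m)
  have "s (Suc m) * (\<Sum>j<Suc m. c j) \<le> s m * (\<Sum>j<Suc m. c j)"
    using Suc.prems(1)[of "Suc m"] Suc.prems(2)[of m "Suc m"] by (intro mult_right_mono) auto
  also have "\<dots> \<le> (\<Sum>j<Suc m. c j * s j)"
    using Suc.prems by (intro Suc.IH) auto
  finally show ?case by (simp add: algebra_simps)
qed simp

lemma sum_antimono_weights_nonneg:
  fixes c s :: "nat \<Rightarrow> real"
  assumes c: "\<And>r. r \<le> m \<Longrightarrow> 0 \<le> (\<Sum>j<r. c j)"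
    and s: "\<And>j k. j \<le> k \<Longrightarrow> k < m \<Longrightarrow> s k \<le> s j" "\<And>j. j < m \<Longrightarrow> 0 \<le> s j"
  shows "0 \<le> (\<Sum>j<m. c j * s j)"
proof (cases m)
  case (Suc n)
  have "0 \<le> s n * (\<Sum>j<Suc n. c j)"
    using c[of "Suc n"] s(2)[of n] Suc by simp
  also have "\<dots> \<le> (\<Sum>j<Suc n. c j * s j)"
    using c s Suc by (intro sum_antimono_weights_ge) auto
  finally show ?thesis using Suc by simp
qed simp

text \<open>
  By summation by parts against \<open>s\<close>, replacing \<open>y\<close> with the running maxima, which
  dominate it in every prefix sum, only increases the linear term. It then remains to complete the
  square.
\<close>

lemma sum_antimono_le_tail_max:
  fixes y s :: "nat \<Rightarrow> real"
  assumes s: "\<And>j k. j \<le> k \<Longrightarrow> k < m \<Longrightarrow> s k \<le> s j" "\<And>j. j < m \<Longrightarrow> 0 \<le> s j"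
  shows "(\<Sum>j<m. 2 * y j * s j - (s j)\<^sup>2) \<le> (\<Sum>j<m. (tail_max m y (m - Suc j))\<^sup>2)"
proof -
  let ?T = "\<lambda>j. tail_max m y (m - Suc j)"
  have "0 \<le> (\<Sum>j<r. ?T j - y j)" if "r \<le> m" for r
  proof -
    \<comment> \<open>\<open>?T j\<close> is the maximum over all prefix lengths from
      \<open>Suc j\<close> to \<open>m\<close>, and \<open>r\<close> is one of these lengths; it
      corresponds to the index \<open>m - r\<close> of the running maximum.\<close>
    have "prefix_mean y r \<le> ?T j" if "j < r" for j
      using run_max_ge[of "m - r" "m - Suc j" "\<lambda>e. max 0 (prefix_mean y (m - e))"] that \<open>r \<le> m\<close>
      by (simp add: tail_max_def)
    then have "(\<Sum>j<r. prefix_mean y r) \<le> (\<Sum>j<r. ?T j)"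
      by (intro sum_mono) auto
    moreover have "(\<Sum>j<r. prefix_mean y r) = (\<Sum>j<r. y j)"
      by (simp add: prefix_mean_def)
    ultimately show ?thesis by (simp add: sum_subtractf)
  qed
  then have "0 \<le> (\<Sum>j<m. (?T j - y j) * s j)"
    using s by (rule sum_antimono_weights_nonneg)
  moreover have "(\<Sum>j<m. 2 * y j * s j - (s j)\<^sup>2) + 2 * (\<Sum>j<m. (?T j - y j) * s j)
      \<le> (\<Sum>j<m. (?T j)\<^sup>2)"
  proof -
    have "2 * y j * s j - (s j)\<^sup>2 + 2 * ((?T j - y j) * s j) \<le> (?T j)\<^sup>2" for j
      using zero_le_power2[of "?T j - s j"] by (simp add: power2_eq_square algebra_simps)
    then show ?thesis
      unfolding sum_distrib_left sum.distrib[symmetric] by (rule sum_mono)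
  qed
  ultimately show ?thesis by linarith
qed

text \<open>At each index at most one of the positive and the negative part of \<open>t\<close> is
  nonzero, so the quadratic term splits along with the linear one. The negative part is
  non-increasing as it stands and meets the noise \<open>- y\<close>; the positive part becomes
  non-increasing once the order is reversed, which is why \<open>y\<close> appears backwards in the
  first sum.\<close>

lemma sum_mono_le_tail_max:
  fixes y t :: "nat \<Rightarrow> real"
  assumes t: "\<And>j k. j \<le> k \<Longrightarrow> k < m \<Longrightarrow> t j \<le> t k"
  shows "(\<Sum>j<m. 2 * y j * t j - (t j)\<^sup>2)
    \<le> (\<Sum>j<m. (tail_max m (\<lambda>j. y (m - Suc j)) (m - Suc j))\<^sup>2)
      + (\<Sum>j<m. (tail_max m (\<lambda>j. - y j) (m - Suc j))\<^sup>2)"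
proof -
  have "2 * y j * t j - (t j)\<^sup>2 = (2 * y j * max 0 (t j) - (max 0 (t j))\<^sup>2)
      + (2 * (- y j) * max 0 (- t j) - (max 0 (- t j))\<^sup>2)" for j
    by (simp add: max_def)
  then have "(\<Sum>j<m. 2 * y j * t j - (t j)\<^sup>2) = (\<Sum>j<m. 2 * y j * max 0 (t j) - (max 0 (t j))\<^sup>2)
      + (\<Sum>j<m. 2 * (- y j) * max 0 (- t j) - (max 0 (- t j))\<^sup>2)"
    by (simp add: sum.distrib)
  also have "(\<Sum>j<m. 2 * y j * max 0 (t j) - (max 0 (t j))\<^sup>2)
      = (\<Sum>j<m. 2 * y (m - Suc j) * max 0 (t (m - Suc j)) - (max 0 (t (m - Suc j)))\<^sup>2)"
    by (subst sum.nat_diff_reindex[symmetric]) simp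
  also have "\<dots> \<le> (\<Sum>j<m. (tail_max m (\<lambda>j. y (m - Suc j)) (m - Suc j))\<^sup>2)"
    using t by (intro sum_antimono_le_tail_max max.mono) auto
  also have "(\<Sum>j<m. 2 * (- y j) * max 0 (- t j) - (max 0 (- t j))\<^sup>2)
      \<le> (\<Sum>j<m. (tail_max m (\<lambda>j. - y j) (m - Suc j))\<^sup>2)"
    using t by (intro sum_antimono_le_tail_max max.mono) auto
  finally show ?thesis by simp
qed

section \<open>Square integrability, measurability and reindexing of independent families\<close>

lemma integrable_mult_square:
  fixes f g :: "'a \<Rightarrow> real"
  assumes [measurable]: "f \<in> borel_measurable M" "g \<in> borel_measurable M"
    and "integrable M (\<lambda>x. (f x)\<^sup>2)" "integrable M (\<lambda>x. (g x)\<^sup>2)"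
  shows "integrable M (\<lambda>x. f x * g x)"
proof (rule Bochner_Integration.integrable_bound)
  show "integrable M (\<lambda>x. (f x)\<^sup>2 + (g x)\<^sup>2)"
    using assms by simp
  have "\<bar>f x * g x\<bar> \<le> (f x)\<^sup>2 + (g x)\<^sup>2" for x
    using sum_squares_bound[of "\<bar>f x\<bar>" "\<bar>g x\<bar>"]
      mult_nonneg_nonneg[OF abs_ge_zero[of "f x"] abs_ge_zero[of "g x"]]
    unfolding abs_mult power2_abs by linarith
  then show "AE x in M. norm (f x * g x) \<le> norm ((f x)\<^sup>2 + (g x)\<^sup>2)"
    by simp
qed simp

lemma integrable_square_sum:
  fixes f :: "'i \<Rightarrow> 'a \<Rightarrow> real"
  assumes "\<And>i. i \<in> I \<Longrightarrow> f i \<in> borel_measurable M"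
    and "\<And>i. i \<in> I \<Longrightarrow> integrable M (\<lambda>x. (f i x)\<^sup>2)"
  shows "integrable M (\<lambda>x. (\<Sum>i\<in>I. f i x)\<^sup>2)"
  unfolding power2_eq_square sum_product
  using assms by (intro Bochner_Integration.integrable_sum integrable_mult_square)

lemma integrable_square_max:
  fixes f g :: "'a \<Rightarrow> real"
  assumes [measurable]: "f \<in> borel_measurable M" "g \<in> borel_measurable M"
    and "integrable M (\<lambda>x. (f x)\<^sup>2)" "integrable M (\<lambda>x. (g x)\<^sup>2)"
  shows "integrable M (\<lambda>x. (max (f x) (g x))\<^sup>2)"
proof (rule Bochner_Integration.integrable_bound)
  show "integrable M (\<lambda>x. (f x)\<^sup>2 + (g x)\<^sup>2)"
    using assms by simp
qed (auto simp: max_def)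

lemma measurable_prefix_mean:
  "(\<And>j. j < r \<Longrightarrow> (\<lambda>\<omega>. x \<omega> j) \<in> borel_measurable N) \<Longrightarrow> (\<lambda>\<omega>. prefix_mean (x \<omega>) r) \<in> borel_measurable N"
  unfolding prefix_mean_def by (intro borel_measurable_divide borel_measurable_sum) auto

lemma measurable_tail_max:
  assumes "\<And>j. j < m \<Longrightarrow> (\<lambda>\<omega>. x \<omega> j) \<in> borel_measurable N"
  shows "(\<lambda>\<omega>. tail_max m (x \<omega>) d) \<in> borel_measurable N"
proof -
  have [measurable]: "(\<lambda>\<omega>. prefix_mean (x \<omega>) r) \<in> borel_measurable N" if "r \<le> m" for r
    using that by (intro measurable_prefix_mean assms) simp
  show ?thesis
    unfolding tail_max_def by (induction d) simp_all
qed

text \<open>A finite subfamily over \<open>J\<close> is carried by \<open>f\<close> to a finite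
  subfamily over \<open>I\<close>, and injectivity keeps its factors from merging. This serves for
  swaps, for reversal and for the enumeration of a block.\<close>

lemma (in prob_space) indep_sets_reindex:
  assumes f: "inj_on f J" "f ` J \<subseteq> I" and F: "indep_sets F I"
  shows "indep_sets (\<lambda>j. F (f j)) J"
proof (rule indep_setsI)
  show "F (f j) \<subseteq> events" if "j \<in> J" for j
    using F f that by (auto simp: indep_sets_def)
next
  fix A K assume K: "K \<noteq> {}" "K \<subseteq> J" "finite K" and A: "\<forall>j\<in>K. A j \<in> F (f j)"
  define g where "g = the_inv_into K f"
  have inj: "inj_on f K" using f K by (auto intro: inj_on_subset)
  have g: "g (f j) = j" if "j \<in> K" for j
    using that inj by (simp add: g_def the_inv_into_f_f)
  have "prob (\<Inter>j\<in>K. A j) = prob (\<Inter>i\<in>f ` K. A (g i))"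
    by (simp add: g)
  also have "\<dots> = (\<Prod>i\<in>f ` K. prob (A (g i)))"
    using K f A by (intro indep_setsD[OF F]) (auto simp: g)
  also have "\<dots> = (\<Prod>j\<in>K. prob (A j))"
    by (simp add: prod.reindex[OF inj] g)
  finally show "prob (\<Inter>j\<in>K. A j) = (\<Prod>j\<in>K. prob (A j))" .
qed

lemma (in prob_space) indep_vars_reindex:
  assumes f: "inj_on f J" "f ` J \<subseteq> I" and X: "indep_vars M' X I"
  shows "indep_vars (\<lambda>j. M' (f j)) (\<lambda>j. X (f j)) J"
  using X f indep_sets_reindex[OF f]
  unfolding indep_vars_def2 by auto

section \<open>Maximal inequality for finite i.i.d. sequences\<close>

locale iid_finite_sequence = prob_space +
  fixes X :: "nat \<Rightarrow> 'a \<Rightarrow> real" and m :: nat and v :: real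
  assumes indep: "indep_vars (\<lambda>_. borel) X {..<m}"
    and ident: "\<And>j k. j < m \<Longrightarrow> k < m \<Longrightarrow> distr M borel (X j) = distr M borel (X k)"
    and square_integrable: "\<And>j. j < m \<Longrightarrow> integrable M (\<lambda>\<omega>. (X j \<omega>)\<^sup>2)"
    and mean: "\<And>j. j < m \<Longrightarrow> expectation (X j) = 0"
    and second_moment: "\<And>j. j < m \<Longrightarrow> expectation (\<lambda>\<omega>. (X j \<omega>)\<^sup>2) = v"
begin

lemma rv [measurable (raw)]: "j < m \<Longrightarrow> random_variable borel (X j)"
  using indep by (auto simp: indep_vars_def2)

lemma integrable_X: "j < m \<Longrightarrow> integrable M (X j)"
  using rv square_integrable by (rule square_integrable_imp_integrable)

text \<open>By independence the joint law is the product of the marginals; these coincide, so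
  permuting the coordinates leaves the law unchanged. Product measures live on functions restricted
  to the index set, hence the condition that \<open>F\<close> sees only the first \<open>m\<close>
  coordinates.\<close>

lemma exchangeable:
  fixes F :: "(nat \<Rightarrow> real) \<Rightarrow> real"
  assumes \<tau>: "inj_on \<tau> {..<m}" "\<tau> ` {..<m} \<subseteq> {..<m}"
    and F: "F \<in> borel_measurable (\<Pi>\<^sub>M j\<in>{..<m}. borel)"
    and restr: "\<And>x. F (restrict x {..<m}) = F x"
  shows "expectation (\<lambda>\<omega>. F (\<lambda>j. X (\<tau> j) \<omega>)) = expectation (\<lambda>\<omega>. F (\<lambda>j. X j \<omega>))"
proof (cases "m = 0")
  \<comment> \<open>The characterisation of independence by product measures asks for a non-empty
    index set; with no coordinates to depend on, \<open>F\<close> is constant.\<close>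
  case True
  have "F x = F y" for x y
    using restr[of x] restr[of y] True by (simp add: restrict_def)
  then have "(\<lambda>\<omega>. F (\<lambda>j. X (\<tau> j) \<omega>)) = (\<lambda>\<omega>. F (\<lambda>j. X j \<omega>))"
    by blast
  then show ?thesis by simp
next
  case False
  let ?P = "\<Pi>\<^sub>M j\<in>{..<m}. borel :: real measure"
  have \<tau>m: "\<tau> j < m" if "j < m" for j
    using \<tau> that by auto
  have ne: "{..<m} \<noteq> {}" using False by auto
  have 1: "distr M ?P (\<lambda>\<omega>. \<lambda>j\<in>{..<m}. X j \<omega>) = (\<Pi>\<^sub>M j\<in>{..<m}. distr M borel (X j))"
    using indep by (subst (asm) indep_vars_iff_distr_eq_PiM'[OF ne]) (auto intro: rv)
  have 2: "distr M ?P (\<lambda>\<omega>. \<lambda>j\<in>{..<m}. X (\<tau> j) \<omega>) = (\<Pi>\<^sub>M j\<in>{..<m}. distr M borel (X (\<tau> j)))"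
    using indep_vars_reindex[OF \<tau> indep]
    by (subst (asm) indep_vars_iff_distr_eq_PiM'[OF ne]) (auto intro: rv \<tau>m)
  have "(\<Pi>\<^sub>M j\<in>{..<m}. distr M borel (X (\<tau> j))) = (\<Pi>\<^sub>M j\<in>{..<m}. distr M borel (X j))"
    using \<tau>m by (intro PiM_cong refl ident) auto
  with 1 2 have eq: "distr M ?P (\<lambda>\<omega>. \<lambda>j\<in>{..<m}. X (\<tau> j) \<omega>) = distr M ?P (\<lambda>\<omega>. \<lambda>j\<in>{..<m}. X j \<omega>)"
    by simp
  have "expectation (\<lambda>\<omega>. F (\<lambda>j. X (\<tau> j) \<omega>)) = expectation (\<lambda>\<omega>. F (\<lambda>j\<in>{..<m}. X (\<tau> j) \<omega>))"
    using restr by simp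
  also have "\<dots> = integral\<^sup>L (distr M ?P (\<lambda>\<omega>. \<lambda>j\<in>{..<m}. X (\<tau> j) \<omega>)) F"
    using F by (intro integral_distr[symmetric] measurable_restrict) (auto intro: rv \<tau>m)
  also have "\<dots> = integral\<^sup>L (distr M ?P (\<lambda>\<omega>. \<lambda>j\<in>{..<m}. X j \<omega>)) F"
    by (simp add: eq)
  also have "\<dots> = expectation (\<lambda>\<omega>. F (\<lambda>j\<in>{..<m}. X j \<omega>))"
    using F by (intro integral_distr measurable_restrict) (auto intro: rv)
  also have "\<dots> = expectation (\<lambda>\<omega>. F (\<lambda>j. X j \<omega>))"
    using restr by simp
  finally show ?thesis .
qed

lemma square_integrable_prefix_mean:
  assumes "r \<le> m"
  shows "integrable M (\<lambda>\<omega>. (prefix_mean (\<lambda>j. X j \<omega>) r)\<^sup>2)"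
  unfolding prefix_mean_def power_divide
  using assms by (intro integrable_divide_zero integrable_square_sum) (auto intro: rv square_integrable)

lemma square_integrable_prefix_mean_pos:
  assumes "r \<le> m"
  shows "integrable M (\<lambda>\<omega>. (max 0 (prefix_mean (\<lambda>j. X j \<omega>) r))\<^sup>2)"
  using assms
  by (intro integrable_square_max square_integrable_prefix_mean measurable_prefix_mean)
     (auto intro: rv)

lemma measurable_tail_max_X: "(\<lambda>\<omega>. tail_max m (\<lambda>j. X j \<omega>) d) \<in> borel_measurable M"
  by (intro measurable_tail_max rv)

text \<open>This covers every \<open>d\<close>: beyond \<open>m\<close> the truncated subtraction
  gives prefix length 0, whose mean is 0 by the convention for division by zero.\<close>

lemma square_integrable_tail_max:
  "integrable M (\<lambda>\<omega>. (tail_max m (\<lambda>j. X j \<omega>) d)\<^sup>2)"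
proof (induction d)
  case 0
  then show ?case
    by (simp add: tail_max_def square_integrable_prefix_mean_pos)
next
  case (Suc d)
  have eq: "tail_max m x (Suc d) = max (tail_max m x d) (max 0 (prefix_mean x (m - Suc d)))" for x
    by (simp add: tail_max_def)
  show ?case
    unfolding eq
    by (intro integrable_square_max Suc.IH square_integrable_prefix_mean_pos measurable_tail_max_X
        borel_measurable_max measurable_prefix_mean rv) auto
qed

lemma integrable_drift:
  "integrable M (\<lambda>\<omega>. tail_max m (\<lambda>j. X j \<omega>) d *
    (max 0 (prefix_mean (\<lambda>j. X j \<omega>) (m - Suc d)) - max 0 (prefix_mean (\<lambda>j. X j \<omega>) (m - d))))"
  unfolding right_diff_distrib
  by (intro integrable_mult_square Bochner_Integration.integrable_diff measurable_tail_max_X square_integrable_tail_max borel_measurable_max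
          measurable_prefix_mean rv square_integrable_prefix_mean_pos) auto

text \<open>
  The running maximum up to prefix length \<open>m - d\<close> is symmetric in the first \<open>m - d\<close>
  entries, so exchangeability replaces the conditioning in the usual martingale argument.
\<close>

lemma prefix_mean_drift_nonneg:
  assumes d: "Suc d < m"
  shows "0 \<le> expectation (\<lambda>\<omega>. tail_max m (\<lambda>j. X j \<omega>) d *
    (max 0 (prefix_mean (\<lambda>j. X j \<omega>) (m - Suc d)) - max 0 (prefix_mean (\<lambda>j. X j \<omega>) (m - d))))"
    (is "0 \<le> expectation ?G")
proof -
  \<comment> \<open>\<open>Suc d < m\<close> makes \<open>r\<close> positive. A prefix of length 0
    would have mean 0 by convention, and the comparison of consecutive means would fail
    there.\<close>
  define r where "r = m - Suc d"
  have r: "m - d = Suc r" "r > 0" "Suc r \<le> m" "m - Suc d = r"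
    using d by (auto simp: r_def)
  \<comment> \<open>The indicator is a subgradient of the positive part at the longer mean. By
    convexity, \<open>h\<close> times the difference of the means bounds the drift from below, which
    makes the problem linear in the means.\<close>
  define h :: "(nat \<Rightarrow> real) \<Rightarrow> real" where
    "h x = tail_max m x d * (if 0 < prefix_mean x (Suc r) then 1 else 0)" for x
  have meas_h: "(\<lambda>\<omega>. h (x \<omega>)) \<in> borel_measurable N"
    if [measurable]: "\<And>j. j < m \<Longrightarrow> (\<lambda>\<omega>. x \<omega> j) \<in> borel_measurable N"
    for N :: "'b measure" and x
  proof -
    have [measurable]: "(\<lambda>\<omega>. prefix_mean (x \<omega>) (Suc r)) \<in> borel_measurable N"
      using r by (intro measurable_prefix_mean that) auto
    have [measurable]: "(\<lambda>\<omega>. tail_max m (x \<omega>) d) \<in> borel_measurable N"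
      by (intro measurable_tail_max that)
    show ?thesis unfolding h_def by measurable
  qed
  have h_cong: "h x = h y" if "\<And>s. Suc r \<le> s \<Longrightarrow> s \<le> m \<Longrightarrow> prefix_mean x s = prefix_mean y s" for x y
  proof -
    have "tail_max m x d = tail_max m y d"
      using that r by (intro tail_max_cong) auto
    with that[of "Suc r"] r show ?thesis by (simp add: h_def)
  qed
  have h_restr: "h (restrict x {..<m}) = h x" for x
    by (intro h_cong prefix_mean_cong) auto
  have h_swap: "h (\<lambda>j. x (Transposition.transpose j0 r j)) = h x" if "j0 < r" for x j0
  proof (intro h_cong)
    fix s assume "Suc r \<le> s"
    then have "(\<Sum>j<s. x (Transposition.transpose j0 r j)) = (\<Sum>j<s. x j)"
      using that by (intro sum.reindex_bij_witness[of _ "Transposition.transpose j0 r" "Transposition.transpose j0 r"])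
        (auto simp: Transposition.transpose_def)
    then show "prefix_mean (\<lambda>j. x (Transposition.transpose j0 r j)) s = prefix_mean x s"
      by (simp add: prefix_mean_def)
  qed
  let ?X = "\<lambda>\<omega> j. X j \<omega>"
  have sq_h: "integrable M (\<lambda>\<omega>. (h (?X \<omega>))\<^sup>2)"
  proof (rule Bochner_Integration.integrable_bound[OF square_integrable_tail_max[of d]])
    show "(\<lambda>\<omega>. (h (?X \<omega>))\<^sup>2) \<in> borel_measurable M"
      by (intro borel_measurable_power meas_h rv)
  qed (auto simp: h_def)
  have int_h: "integrable M (\<lambda>\<omega>. h (?X \<omega>) * X j \<omega>)" if "j < m" for j
    using that by (intro integrable_mult_square meas_h rv sq_h square_integrable)
  \<comment> \<open>Positions \<open>j\<close> and \<open>r\<close> both lie among the first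
    \<open>Suc r\<close>, so swapping them fixes \<open>h\<close> while exchanging the other
    factor.\<close>
  have swap: "expectation (\<lambda>\<omega>. h (?X \<omega>) * X j \<omega>) = expectation (\<lambda>\<omega>. h (?X \<omega>) * X r \<omega>)"
    if "j < Suc r" for j
  proof (cases "j = r")
    case False
    with that have "j < r" by simp
    let ?\<tau> = "Transposition.transpose j r"
    have "expectation (\<lambda>\<omega>. (\<lambda>x. h x * x r) (\<lambda>i. X (?\<tau> i) \<omega>))
        = expectation (\<lambda>\<omega>. (\<lambda>x. h x * x r) (\<lambda>i. X i \<omega>))"
    proof (rule exchangeable)
      show "(\<lambda>x. h x * x r) \<in> borel_measurable (Pi\<^sub>M {..<m} (\<lambda>j. borel))"
        using r by (intro borel_measurable_times meas_h measurable_component_singleton) auto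
      show "inj_on ?\<tau> {..<m}" "?\<tau> ` {..<m} \<subseteq> {..<m}"
        using \<open>j < r\<close> r by (auto simp: Transposition.transpose_def inj_on_def split: if_splits)
      show "h (restrict x {..<m}) * restrict x {..<m} r = h x * x r" for x
        using r by (simp only: h_restr) simp
    qed
    moreover have "h (\<lambda>i. X (?\<tau> i) \<omega>) = h (?X \<omega>)" for \<omega>
      by (rule h_swap[OF \<open>j < r\<close>, of "?X \<omega>"])
    ultimately show ?thesis by simp
  qed simp
  have lin: "expectation (\<lambda>\<omega>. h (?X \<omega>) * (\<Sum>j<s. X j \<omega>)) = s * expectation (\<lambda>\<omega>. h (?X \<omega>) * X r \<omega>)"
    if "s \<le> Suc r" for s
  proof -
    have "expectation (\<lambda>\<omega>. h (?X \<omega>) * (\<Sum>j<s. X j \<omega>)) = (\<Sum>j<s. expectation (\<lambda>\<omega>. h (?X \<omega>) * X j \<omega>))"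
      unfolding sum_distrib_left
      using that r by (intro Bochner_Integration.integral_sum int_h) auto
    also have "\<dots> = (\<Sum>j<s. expectation (\<lambda>\<omega>. h (?X \<omega>) * X r \<omega>))"
      using that by (intro sum.cong swap) auto
    finally show ?thesis by simp
  qed
  have int_mean: "integrable M (\<lambda>\<omega>. h (?X \<omega>) * prefix_mean (?X \<omega>) s)" if "s \<le> m" for s
    using that by (intro integrable_mult_square meas_h rv sq_h square_integrable_prefix_mean
        measurable_prefix_mean) auto
  have mean_eq: "expectation (\<lambda>\<omega>. h (?X \<omega>) * prefix_mean (?X \<omega>) s)
      = expectation (\<lambda>\<omega>. h (?X \<omega>) * X r \<omega>)" if "0 < s" "s \<le> Suc r" for s
    using lin[of s] that by (simp add: prefix_mean_def)
  have int_diff: "integrable M (\<lambda>\<omega>. h (?X \<omega>) * prefix_mean (?X \<omega>) r - h (?X \<omega>) * prefix_mean (?X \<omega>) (Suc r))"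
    using r by (intro Bochner_Integration.integrable_diff int_mean) auto
  \<comment> \<open>Both means have the same expected product with \<open>h\<close>, namely that of
    the single entry \<open>X r\<close>, so the linearised drift vanishes. This stands in for the
    martingale property.\<close>
  have "0 = expectation (\<lambda>\<omega>. h (?X \<omega>) * prefix_mean (?X \<omega>) r - h (?X \<omega>) * prefix_mean (?X \<omega>) (Suc r))"
    using r by (subst Bochner_Integration.integral_diff) (auto simp: mean_eq int_mean)
  also have "\<dots> \<le> expectation ?G"
  proof (rule integral_mono[OF int_diff])
    show "integrable M ?G" by (rule integrable_drift)
    fix \<omega>
    have "0 \<le> tail_max m (?X \<omega>) d" by (rule tail_max_nonneg)
    then show "h (?X \<omega>) * prefix_mean (?X \<omega>) r - h (?X \<omega>) * prefix_mean (?X \<omega>) (Suc r) \<le> ?G \<omega>"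
      unfolding r by (auto simp: h_def right_diff_distrib[symmetric] intro!: mult_left_mono)
  qed
  finally show ?thesis .
qed

lemma doob_tail_max:
  assumes "d < m"
  shows "expectation (\<lambda>\<omega>. (tail_max m (\<lambda>j. X j \<omega>) d)\<^sup>2)
    \<le> 4 * expectation (\<lambda>\<omega>. (max 0 (prefix_mean (\<lambda>j. X j \<omega>) (m - d)))\<^sup>2)"
proof -
  let ?p = "\<lambda>\<omega> e. max 0 (prefix_mean (\<lambda>j. X j \<omega>) (m - e))"
  let ?D = "\<lambda>e \<omega>. tail_max m (\<lambda>j. X j \<omega>) e * (?p \<omega> (Suc e) - ?p \<omega> e)"
  have int_p: "integrable M (\<lambda>\<omega>. (?p \<omega> d)\<^sup>2)"
    by (simp add: square_integrable_prefix_mean_pos)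
  have "expectation (\<lambda>\<omega>. (tail_max m (\<lambda>j. X j \<omega>) d)\<^sup>2)
    \<le> expectation (\<lambda>\<omega>. 4 * (?p \<omega> d)\<^sup>2 - 4 * (\<Sum>e<d. ?D e \<omega>))"
  proof (rule integral_mono[OF square_integrable_tail_max])
    show "integrable M (\<lambda>\<omega>. 4 * (?p \<omega> d)\<^sup>2 - 4 * (\<Sum>e<d. ?D e \<omega>))"
      using int_p integrable_drift by simp
    show "(tail_max m (\<lambda>j. X j \<omega>) d)\<^sup>2 \<le> 4 * (?p \<omega> d)\<^sup>2 - 4 * (\<Sum>e<d. ?D e \<omega>)" for \<omega>
      using pathwise_doob[of "?p \<omega>" d] by (simp add: tail_max_def)
  qed
  also have "\<dots> = 4 * expectation (\<lambda>\<omega>. (?p \<omega> d)\<^sup>2) - 4 * (\<Sum>e<d. expectation (?D e))"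
    using int_p integrable_drift by simp
  also have "\<dots> \<le> 4 * expectation (\<lambda>\<omega>. (?p \<omega> d)\<^sup>2)"
    using assms by (auto intro!: sum_nonneg prefix_mean_drift_nonneg)
  finally show ?thesis .
qed

text \<open>Off the diagonal, independence and mean zero annihilate the products; the diagonal
  contributes \<open>r\<close> copies of \<open>v\<close>, to be divided by the square of
  \<open>r\<close>.\<close>

lemma expectation_prefix_mean_square:
  assumes "0 < r" "r \<le> m"
  shows "expectation (\<lambda>\<omega>. (prefix_mean (\<lambda>j. X j \<omega>) r)\<^sup>2) = v / real r"
proof -
  have int: "integrable M (\<lambda>\<omega>. X j \<omega> * X k \<omega>)" if "j < m" "k < m" for j k
    using that by (intro integrable_mult_square rv square_integrable)
  have prod: "expectation (\<lambda>\<omega>. X j \<omega> * X k \<omega>) = (if j = k then v else 0)" if "j < m" "k < m" for j k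
  proof (cases "j = k")
    case True
    then show ?thesis using second_moment[OF that(1)] by (simp add: power2_eq_square)
  next
    case False
    have "expectation (\<lambda>\<omega>. \<Prod>i\<in>{j, k}. X i \<omega>) = (\<Prod>i\<in>{j, k}. expectation (X i))"
      using that by (intro indep_vars_lebesgue_integral indep_vars_subset[OF indep]) (auto intro: integrable_X)
    then show ?thesis using False mean that by simp
  qed
  have "expectation (\<lambda>\<omega>. (\<Sum>j<r. X j \<omega>)\<^sup>2) = (\<Sum>j<r. \<Sum>k<r. expectation (\<lambda>\<omega>. X j \<omega> * X k \<omega>))"
    unfolding power2_eq_square sum_product
    using assms int
    by (subst Bochner_Integration.integral_sum)
      (auto intro!: sum.cong Bochner_Integration.integral_sum Bochner_Integration.integrable_sum)
  also have "\<dots> = (\<Sum>j<r. \<Sum>k<r. if j = k then v else 0)"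
    using assms by (intro sum.cong prod) auto
  also have "\<dots> = real r * v" by simp
  finally show ?thesis
    using assms by (simp add: prefix_mean_def power_divide power2_eq_square)
qed

lemma sum_expectation_tail_max_le:
  "(\<Sum>j<m. expectation (\<lambda>\<omega>. (tail_max m (\<lambda>j. X j \<omega>) (m - Suc j))\<^sup>2))
    \<le> 4 * (\<Sum>j<m. expectation (\<lambda>\<omega>. (max 0 (prefix_mean (\<lambda>j. X j \<omega>) (Suc j)))\<^sup>2))"
  unfolding sum_distrib_left
proof (rule sum_mono)
  fix j assume "j \<in> {..<m}"
  then show "expectation (\<lambda>\<omega>. (tail_max m (\<lambda>j. X j \<omega>) (m - Suc j))\<^sup>2)
      \<le> 4 * expectation (\<lambda>\<omega>. (max 0 (prefix_mean (\<lambda>j. X j \<omega>) (Suc j)))\<^sup>2)"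
    using doob_tail_max[of "m - Suc j"] by simp
qed

text \<open>Reversed and negated sequences are again instances of the locale, so Doob's bound
  applies to both sums in \<open>sum_mono_le_tail_max\<close>.\<close>

lemma iid_reverse: "iid_finite_sequence M (\<lambda>j. X (m - Suc j)) m v"
proof
  show "indep_vars (\<lambda>_. borel) (\<lambda>j. X (m - Suc j)) {..<m}"
    by (rule indep_vars_reindex[OF _ _ indep]) (auto simp: inj_on_def)
  show "distr M borel (X (m - Suc j)) = distr M borel (X (m - Suc k))" if "j < m" "k < m" for j k
    using that by (intro ident) auto
  show "integrable M (\<lambda>\<omega>. (X (m - Suc j) \<omega>)\<^sup>2)" if "j < m" for j
    using that by (intro square_integrable) auto
  show "expectation (X (m - Suc j)) = 0" if "j < m" for j
    using that by (intro mean) auto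
  show "expectation (\<lambda>\<omega>. (X (m - Suc j) \<omega>)\<^sup>2) = v" if "j < m" for j
    using that by (intro second_moment) auto
qed

lemma iid_uminus: "iid_finite_sequence M (\<lambda>j \<omega>. - X j \<omega>) m v"
proof
  show "indep_vars (\<lambda>_. borel) (\<lambda>j \<omega>. - X j \<omega>) {..<m}"
    by (rule indep_vars_compose2[OF indep]) simp
  show "distr M borel (\<lambda>\<omega>. - X j \<omega>) = distr M borel (\<lambda>\<omega>. - X k \<omega>)" if "j < m" "k < m" for j k
    using ident[OF that] distr_distr[of uminus borel borel "X j" M] distr_distr[of uminus borel borel "X k" M]
      that rv by (simp add: comp_def)
qed (auto simp: square_integrable mean second_moment)

lemma expectation_prefix_mean_reverse:
  assumes "r \<le> m"
  shows "expectation (\<lambda>\<omega>. (max 0 (prefix_mean (\<lambda>j. X (m - Suc j) \<omega>) r))\<^sup>2)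
    = expectation (\<lambda>\<omega>. (max 0 (prefix_mean (\<lambda>j. X j \<omega>) r))\<^sup>2)"
proof (rule exchangeable[of "\<lambda>j. m - Suc j" "\<lambda>x. (max 0 (prefix_mean x r))\<^sup>2"])
  show "(\<lambda>x. (max 0 (prefix_mean x r))\<^sup>2) \<in> borel_measurable (Pi\<^sub>M {..<m} (\<lambda>j. borel))"
    using assms by (intro borel_measurable_power borel_measurable_max borel_measurable_const
        measurable_prefix_mean measurable_component_singleton) auto
  show "(max 0 (prefix_mean (restrict x {..<m}) r))\<^sup>2 = (max 0 (prefix_mean x r))\<^sup>2" for x
    using assms by (subst prefix_mean_cong[of r "restrict x {..<m}" x]) auto
qed (auto simp: inj_on_def)

text \<open>
  Reversing the sequence does not change the law of its prefix means, so the positive part from the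
  reversed sequence and the negative part from the original one combine into a single second
  moment. This saves a factor 2.
\<close>

lemma expectation_two_sided_tail_max_le:
  "expectation (\<lambda>\<omega>. (\<Sum>j<m. (tail_max m (\<lambda>j. X (m - Suc j) \<omega>) (m - Suc j))\<^sup>2)
      + (\<Sum>j<m. (tail_max m (\<lambda>j. - X j \<omega>) (m - Suc j))\<^sup>2)) \<le> 4 * v * harm m" (is ?bound)
  and integrable_two_sided_tail_max:
  "integrable M (\<lambda>\<omega>. (\<Sum>j<m. (tail_max m (\<lambda>j. X (m - Suc j) \<omega>) (m - Suc j))\<^sup>2)
      + (\<Sum>j<m. (tail_max m (\<lambda>j. - X j \<omega>) (m - Suc j))\<^sup>2))" (is ?int)
proof -
  interpret rev: iid_finite_sequence M "\<lambda>j. X (m - Suc j)" m v by (rule iid_reverse)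
  interpret neg: iid_finite_sequence M "\<lambda>j \<omega>. - X j \<omega>" m v by (rule iid_uminus)
  note int = rev.square_integrable_tail_max neg.square_integrable_tail_max
  from int show ?int by simp
  let ?p = "\<lambda>\<omega> j. prefix_mean (\<lambda>j. X j \<omega>) (Suc j)"
  have "expectation (\<lambda>\<omega>. (\<Sum>j<m. (tail_max m (\<lambda>j. X (m - Suc j) \<omega>) (m - Suc j))\<^sup>2)
      + (\<Sum>j<m. (tail_max m (\<lambda>j. - X j \<omega>) (m - Suc j))\<^sup>2))
    = (\<Sum>j<m. expectation (\<lambda>\<omega>. (tail_max m (\<lambda>j. X (m - Suc j) \<omega>) (m - Suc j))\<^sup>2))
      + (\<Sum>j<m. expectation (\<lambda>\<omega>. (tail_max m (\<lambda>j. - X j \<omega>) (m - Suc j))\<^sup>2))"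
    using int by simp
  also have "\<dots> \<le> 4 * (\<Sum>j<m. expectation (\<lambda>\<omega>. (max 0 (prefix_mean (\<lambda>j. X (m - Suc j) \<omega>) (Suc j)))\<^sup>2))
      + 4 * (\<Sum>j<m. expectation (\<lambda>\<omega>. (max 0 (prefix_mean (\<lambda>j. - X j \<omega>) (Suc j)))\<^sup>2))"
    by (intro add_mono rev.sum_expectation_tail_max_le neg.sum_expectation_tail_max_le)
  also have "\<dots> = 4 * (\<Sum>j<m. expectation (\<lambda>\<omega>. (max 0 (?p \<omega> j))\<^sup>2)
      + expectation (\<lambda>\<omega>. (max 0 (prefix_mean (\<lambda>j. - X j \<omega>) (Suc j)))\<^sup>2))"
    by (simp add: expectation_prefix_mean_reverse sum.distrib)
  also have "\<dots> = 4 * (\<Sum>j<m. v / real (Suc j))"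
  proof (intro arg_cong[of _ _ "\<lambda>x. 4 * x"] sum.cong refl)
    fix j assume j: "j \<in> {..<m}"
    have "expectation (\<lambda>\<omega>. (max 0 (?p \<omega> j))\<^sup>2)
        + expectation (\<lambda>\<omega>. (max 0 (prefix_mean (\<lambda>j. - X j \<omega>) (Suc j)))\<^sup>2)
      = expectation (\<lambda>\<omega>. (max 0 (?p \<omega> j))\<^sup>2 + (max 0 (prefix_mean (\<lambda>j. - X j \<omega>) (Suc j)))\<^sup>2)"
      using j by (intro Bochner_Integration.integral_add[symmetric] square_integrable_prefix_mean_pos
          neg.square_integrable_prefix_mean_pos) auto
    also have "\<dots> = expectation (\<lambda>\<omega>. (?p \<omega> j)\<^sup>2)"
    proof (rule Bochner_Integration.integral_cong[OF refl])
      fix \<omega>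
      have "prefix_mean (\<lambda>j. - X j \<omega>) (Suc j) = - ?p \<omega> j"
        unfolding prefix_mean_def sum_negf minus_divide_left ..
      then show "(max 0 (?p \<omega> j))\<^sup>2 + (max 0 (prefix_mean (\<lambda>j. - X j \<omega>) (Suc j)))\<^sup>2 = (?p \<omega> j)\<^sup>2"
        by (simp add: max_def)
    qed
    also have "\<dots> = v / real (Suc j)"
      using j by (intro expectation_prefix_mean_square) auto
    finally show "expectation (\<lambda>\<omega>. (max 0 (?p \<omega> j))\<^sup>2)
        + expectation (\<lambda>\<omega>. (max 0 (prefix_mean (\<lambda>j. - X j \<omega>) (Suc j)))\<^sup>2) = v / real (Suc j)" .
  qed
  also have "\<dots> = 4 * v * harm m"
    by (simp add: harm_def sum.atLeast1_atMost_eq sum_distrib_left field_simps)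
  finally show ?bound .
qed

end

section \<open>Noise bound on one block and its sum over the blocks\<close>

lemma harm_le_one_plus_ln: "0 < m \<Longrightarrow> harm m \<le> 1 + ln (real m)"
  using euler_mascheroni_sequence_decreasing[of 1 m] by (simp add: harm_def)

text \<open>\<open>Z\<close> is chosen before \<open>t\<close>, because \<open>t\<close> will be
  built from the estimator and thus depends on the same noise; only a bound uniform in
  \<open>t\<close> can be averaged.\<close>

lemma (in prob_space) monotone_block_bound:
  fixes \<epsilon> :: "'i::linorder \<Rightarrow> 'a \<Rightarrow> real"
  assumes B: "finite B" "B \<noteq> {}"
    and indep: "indep_vars (\<lambda>_. borel) \<epsilon> B"
    and ident: "\<And>i j. i \<in> B \<Longrightarrow> j \<in> B \<Longrightarrow> distr M borel (\<epsilon> i) = distr M borel (\<epsilon> j)"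
    and int: "\<And>i. i \<in> B \<Longrightarrow> integrable M (\<lambda>\<omega>. (\<epsilon> i \<omega>)\<^sup>2)"
    and mean: "\<And>i. i \<in> B \<Longrightarrow> expectation (\<epsilon> i) = 0"
    and moment: "\<And>i. i \<in> B \<Longrightarrow> expectation (\<lambda>\<omega>. (\<epsilon> i \<omega>)\<^sup>2) = v"
  shows "\<exists>Z. integrable M Z \<and> expectation Z \<le> 4 * v * (1 + ln (real (card B))) \<and>
    (\<forall>\<omega> t. mono_on B t \<longrightarrow> (\<Sum>i\<in>B. 2 * \<epsilon> i \<omega> * t i - (t i)\<^sup>2) \<le> Z \<omega>)"
proof -
  define m where "m = card B"
  define b where "b j = sorted_list_of_set B ! j" for j
  have b: "bij_betw b {..<m} B"
    unfolding b_def m_def using B by (intro bij_betw_nth) auto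
  have bB: "b j \<in> B" if "j < m" for j
    using b that by (auto simp: bij_betw_def)
  have b_mono: "b j \<le> b k" if "j \<le> k" "k < m" for j k
    using that B by (auto simp: b_def m_def intro: sorted_nth_mono)
  have "m > 0" using B by (auto simp: m_def card_gt_0_iff)
  have "indep_vars (\<lambda>_. borel) (\<lambda>j. \<epsilon> (b j)) {..<m}"
    using b by (intro indep_vars_reindex[OF _ _ indep]) (auto simp: bij_betw_def)
  then interpret iid_finite_sequence M "\<lambda>j. \<epsilon> (b j)" m v
    using bB by unfold_locales (simp_all add: ident int mean moment)
  define Z where "Z \<omega> = (\<Sum>j<m. (tail_max m (\<lambda>j. \<epsilon> (b (m - Suc j)) \<omega>) (m - Suc j))\<^sup>2)
      + (\<Sum>j<m. (tail_max m (\<lambda>j. - \<epsilon> (b j) \<omega>) (m - Suc j))\<^sup>2)" for \<omega>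
  \<comment> \<open>\<open>v\<close> is a free parameter; its sign is read off from the first entry
    of the non-empty block.\<close>
  have "0 \<le> expectation (\<lambda>\<omega>. (\<epsilon> (b 0) \<omega>)\<^sup>2)" by simp
  then have "0 \<le> v" using second_moment[OF \<open>m > 0\<close>] by simp
  have "expectation Z \<le> 4 * v * harm m"
    using expectation_two_sided_tail_max_le by (simp add: Z_def[abs_def])
  also have "\<dots> \<le> 4 * v * (1 + ln (real m))"
    using \<open>0 \<le> v\<close> \<open>m > 0\<close> by (intro mult_left_mono harm_le_one_plus_ln) auto
  finally have "expectation Z \<le> 4 * v * (1 + ln (real m))" .
  moreover have "integrable M Z"
    using integrable_two_sided_tail_max by (simp add: Z_def[abs_def])
  moreover have "(\<Sum>i\<in>B. 2 * \<epsilon> i \<omega> * t i - (t i)\<^sup>2) \<le> Z \<omega>" if "mono_on B t" for \<omega> t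
  proof -
    have "(\<Sum>i\<in>B. 2 * \<epsilon> i \<omega> * t i - (t i)\<^sup>2)
        = (\<Sum>j<m. 2 * \<epsilon> (b j) \<omega> * t (b j) - (t (b j))\<^sup>2)"
      by (rule sum.reindex_bij_betw[OF b, symmetric])
    also have "\<dots> \<le> Z \<omega>"
      unfolding Z_def
      using that bB b_mono by (intro sum_mono_le_tail_max) (auto simp: mono_on_def)
    finally show ?thesis .
  qed
  ultimately show ?thesis by (auto simp: m_def)
qed

text \<open>Jensen's inequality through the tangent of \<open>ln\<close> at the average size
  \<open>n / k\<close>. The constant of the tangent cancels the 1, and the linear terms add up to
  \<open>k\<close>, which becomes the factor \<open>exp 1\<close> inside the logarithm.\<close>

lemma sum_one_plus_ln_le:
  fixes c :: "'v \<Rightarrow> nat"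
  assumes V: "finite V" "V \<noteq> {}" and c: "\<And>v. v \<in> V \<Longrightarrow> 0 < c v"
  shows "(\<Sum>v\<in>V. 1 + ln (real (c v)))
    \<le> real (card V) * ln (exp 1 * real (\<Sum>v\<in>V. c v) / real (card V))"
proof -
  define k where "k = real (card V)"
  define n where "n = real (\<Sum>v\<in>V. c v)"
  have k: "k > 0" using V by (simp add: k_def card_gt_0_iff)
  have n: "n > 0" using V c by (auto simp: n_def intro!: sum_pos)
  have "(\<Sum>v\<in>V. 1 + ln (real (c v))) \<le> (\<Sum>v\<in>V. ln (n / k) + real (c v) * k / n)"
  proof (rule sum_mono)
    fix v assume "v \<in> V"
    have "ln (real (c v)) = ln (n / k) + ln (real (c v) * k / n)"
      using k n c[OF \<open>v \<in> V\<close>] by (simp add: ln_mult ln_div)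
    also have "ln (real (c v) * k / n) \<le> real (c v) * k / n - 1"
      using k n c[OF \<open>v \<in> V\<close>] by (intro ln_le_minus_one) simp
    finally show "1 + ln (real (c v)) \<le> ln (n / k) + real (c v) * k / n" by simp
  qed
  also have "\<dots> = k * ln (n / k) + n * k / n"
    by (simp add: sum.distrib k_def n_def sum_distrib_right flip: sum_divide_distrib)
  also have "\<dots> = k * ln (exp 1 * n / k)"
    using k n by (simp add: ln_mult ln_div algebra_simps)
  finally show ?thesis by (simp add: k_def n_def)
qed

section \<open>Level sets of an isotonic vector and the projection inequality\<close>

lemma num_blocks_eq_card_range:
  fixes \<theta> :: "real ^ 'n::{finite,linorder}"
  assumes "\<theta> \<in> isotonic_cone"
  shows "num_blocks \<theta> = card (range (($) \<theta>))"
proof -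
  let ?J = "{i. \<exists>j. next_index i j \<and> \<theta> $ i < \<theta> $ j}"
  let ?R = "range (($) \<theta>)"
  have mono: "\<theta> $ i \<le> \<theta> $ j" if "i \<le> j" for i j
    using assms that by (simp add: isotonic_cone_def)
  \<comment> \<open>Each value except the largest is matched with the last index at which it is
    attained, since a jump occurs exactly there. The largest value accounts for the
    \<open>+ 1\<close> in \<open>num_blocks\<close>.\<close>
  have "?R - {Max ?R} = ($) \<theta> ` ?J"
  proof (intro equalityI subsetI)
    fix a assume a: "a \<in> ?R - {Max ?R}"
    define i where "i = Max {i. \<theta> $ i = a}"
    have i: "\<theta> $ i = a"
      using Max_in[of "{i. \<theta> $ i = a}"] a by (auto simp: i_def)
    have i_max: "l \<le> i" if "\<theta> $ l = a" for l
      using that by (simp add: i_def)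
    have "a < Max ?R"
      using a by (auto simp: less_le)
    then obtain l where "a < \<theta> $ l"
      by (subst (asm) Max_gr_iff) auto
    then have "i < l" using i mono[of l i] by (auto simp: not_le[symmetric])
    define j where "j = Min {l. i < l}"
    have "j \<in> {l. i < l}" unfolding j_def using \<open>i < l\<close> by (intro Min_in) auto
    then have "i < j" by simp
    have "j \<le> l" if "i < l" for l using that by (simp add: j_def)
    then have "next_index i j" using \<open>i < j\<close> unfolding next_index_def by (metis not_less)
    moreover have "\<theta> $ i < \<theta> $ j"
      using i i_max[of j] mono[of i j] \<open>i < j\<close> by force
    ultimately show "a \<in> ($) \<theta> ` ?J" using i by auto
  next
    fix a assume "a \<in> ($) \<theta> ` ?J"
    then obtain i j where "a = \<theta> $ i" "\<theta> $ i < \<theta> $ j" by auto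
    moreover have "\<theta> $ j \<le> Max ?R" by simp
    ultimately show "a \<in> ?R - {Max ?R}" by auto
  qed
  \<comment> \<open>Of two jump indices, the successor of the smaller is at most the larger, so that
    jump already separates their values.\<close>
  moreover have "inj_on (($) \<theta>) ?J"
  proof (rule linorder_inj_onI')
    fix i i' assume "i \<in> ?J" "i' \<in> ?J" "i < i'"
    then obtain j where "next_index i j" "\<theta> $ i < \<theta> $ j" by auto
    with \<open>i < i'\<close> have "j \<le> i'" by (auto simp: next_index_def not_less[symmetric])
    with mono[of j i'] \<open>\<theta> $ i < \<theta> $ j\<close> show "\<theta> $ i \<noteq> \<theta> $ i'" by auto
  qed
  ultimately have "card (?R - {Max ?R}) = card ?J"
    by (simp add: card_image)
  moreover have "Max ?R \<in> ?R" by (intro Max_in) auto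
  ultimately have "card ?R = card ?J + 1"
    using card_Suc_Diff1[of ?R "Max ?R"] by simp
  then show ?thesis by (simp add: num_blocks_def)
qed

text \<open>Expansion of the variational inequality tested at \<open>\<theta>\<close>. The negative
  square of \<open>t\<close> is kept: it is what makes the noise term bounded from above on each
  block.\<close>

lemma isotonic_lse_oracle_inequality:
  fixes \<theta> \<theta>star e :: "real ^ 'n::{finite,linorder}"
  assumes "\<theta> \<in> isotonic_cone"
  defines "t \<equiv> isotonic_lse (\<theta>star + e) - \<theta>"
  shows "(norm (isotonic_lse (\<theta>star + e) - \<theta>star))\<^sup>2
    \<le> (norm (\<theta>star - \<theta>))\<^sup>2 + (\<Sum>i\<in>UNIV. 2 * e $ i * t $ i - (t $ i)\<^sup>2)"
proof -
  let ?h = "isotonic_lse (\<theta>star + e)"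
  have "inner (\<theta>star + e - ?h) (\<theta> - ?h) \<le> 0"
    unfolding isotonic_lse_eq_closest_point
    by (rule closest_point_dot[OF convex_isotonic_cone closed_isotonic_cone assms(1)])
  then have "(norm (?h - \<theta>star))\<^sup>2 \<le> (norm (\<theta>star - \<theta>))\<^sup>2 + (2 * inner e t - (norm t)\<^sup>2)"
    unfolding t_def power2_norm_eq_inner
    by (simp add: inner_diff_left inner_diff_right inner_add_left inner_add_right inner_commute)
  also have "2 * inner e t - (norm t)\<^sup>2 = (\<Sum>i\<in>UNIV. 2 * e $ i * t $ i - (t $ i)\<^sup>2)"
    unfolding power2_norm_eq_inner inner_vec_def
    by (simp add: sum_subtractf sum_distrib_left power2_eq_square mult.assoc)
  finally show ?thesis by simp
qed

section \<open>Assembly of the risk bound over the level sets of a fixed isotonic vector\<close>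

theorem theorem2p1:
  fixes M :: "'a measure"
    and \<epsilon> Y :: "'a \<Rightarrow> real ^ 'n::{finite,linorder}"
    and \<theta>star :: "real ^ 'n::{finite,linorder}"
    and \<sigma> :: real
  assumes "prob_space M"
    and "prob_space.indep_vars M (\<lambda>_. borel) (\<lambda>i \<omega>. \<epsilon> \<omega> $ i) UNIV"
    and "\<And>i j. distr M borel (\<lambda>\<omega>. \<epsilon> \<omega> $ i) = distr M borel (\<lambda>\<omega>. \<epsilon> \<omega> $ j)"
    and "\<And>i. integrable M (\<lambda>\<omega>. (\<epsilon> \<omega> $ i)\<^sup>2)"
    and "\<And>i. prob_space.expectation M (\<lambda>\<omega>. \<epsilon> \<omega> $ i) = 0"
    and "\<And>i. prob_space.variance M (\<lambda>\<omega>. \<epsilon> \<omega> $ i) = \<sigma>\<^sup>2"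
    and "\<And>\<omega>. Y \<omega> = \<theta>star + \<epsilon> \<omega>"
  shows "prob_space.risk M (\<lambda>\<omega>. isotonic_lse (Y \<omega>)) \<theta>star
     \<le> (INF \<theta>\<in>isotonic_cone.
           1 / real CARD('n) * (norm (\<theta>star - \<theta>))\<^sup>2
         + 4 * \<sigma>\<^sup>2 * real (num_blocks \<theta>) / real CARD('n)
             * ln (exp 1 * real CARD('n) / real (num_blocks \<theta>)))"
proof (rule cINF_greatest)
  show "isotonic_cone \<noteq> {}" using zero_in_isotonic_cone by auto
next
  fix \<theta> :: "real ^ 'n::{finite,linorder}" assume \<theta>: "\<theta> \<in> isotonic_cone"
  interpret prob_space M by fact
  let ?n = "real CARD('n)" and ?k = "real (num_blocks \<theta>)"
  let ?V = "range (($) \<theta>)"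
  define B where "B a = {i. \<theta> $ i = a}" for a
  let ?P = "\<lambda>a Z. integrable M Z \<and> expectation Z \<le> 4 * \<sigma>\<^sup>2 * (1 + ln (real (card (B a)))) \<and>
    (\<forall>\<omega> t. mono_on (B a) t \<longrightarrow> (\<Sum>i\<in>B a. 2 * \<epsilon> \<omega> $ i * t i - (t i)\<^sup>2) \<le> Z \<omega>)"
  have "\<exists>Z. ?P a Z" if "a \<in> ?V" for a
  proof (rule monotone_block_bound)
    show "B a \<noteq> {}" using that by (auto simp: B_def)
    show "indep_vars (\<lambda>_. borel) (\<lambda>i \<omega>. \<epsilon> \<omega> $ i) (B a)"
      by (rule indep_vars_subset[OF assms(2)]) simp
    show "expectation (\<lambda>\<omega>. (\<epsilon> \<omega> $ i)\<^sup>2) = \<sigma>\<^sup>2" for i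
      using assms(6)[of i] by (simp add: assms(5))
  qed (use assms in auto)
  then have "\<forall>a\<in>?V. \<exists>Z. ?P a Z" by (rule ballI)
  then have "\<exists>Z. \<forall>a\<in>?V. ?P a (Z a)" by (rule bchoice)
  then obtain Z where PZ: "\<forall>a\<in>?V. ?P a (Z a)" ..
  have int: "\<And>a. a \<in> ?V \<Longrightarrow> integrable M (Z a)"
    and exp_Z: "\<And>a. a \<in> ?V \<Longrightarrow> expectation (Z a) \<le> 4 * \<sigma>\<^sup>2 * (1 + ln (real (card (B a))))"
    and Z: "\<And>a \<omega> t. a \<in> ?V \<Longrightarrow> mono_on (B a) t
      \<Longrightarrow> (\<Sum>i\<in>B a. 2 * \<epsilon> \<omega> $ i * t i - (t i)\<^sup>2) \<le> Z a \<omega>"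
    using bspec[OF PZ] by blast+
  have card_V: "card ?V = num_blocks \<theta>"
    using num_blocks_eq_card_range[OF \<theta>] by simp
  have sum_card: "(\<Sum>a\<in>?V. card (B a)) = CARD('n)"
    using sum.image_gen[of "UNIV :: 'n set" "\<lambda>_. 1::nat" "($) \<theta>"] by (simp add: B_def)
  have bound: "(norm (isotonic_lse (Y \<omega>) - \<theta>star))\<^sup>2 \<le> (norm (\<theta>star - \<theta>))\<^sup>2 + (\<Sum>a\<in>?V. Z a \<omega>)" for \<omega>
  proof -
    define t where "t = isotonic_lse (Y \<omega>) - \<theta>"
    have "(\<Sum>i\<in>UNIV. 2 * \<epsilon> \<omega> $ i * t $ i - (t $ i)\<^sup>2)
        = (\<Sum>a\<in>?V. \<Sum>i\<in>B a. 2 * \<epsilon> \<omega> $ i * t $ i - (t $ i)\<^sup>2)"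
      using sum.image_gen[of "UNIV :: 'n set" "\<lambda>i. 2 * \<epsilon> \<omega> $ i * t $ i - (t $ i)\<^sup>2" "($) \<theta>"]
      by (simp add: B_def)
    also have "\<dots> \<le> (\<Sum>a\<in>?V. Z a \<omega>)"
    proof (intro sum_mono Z)
      fix a
      \<comment> \<open>On a level set \<open>\<theta>\<close> is constant, so subtracting it
        preserves the monotonicity of the estimator.\<close>
      show "mono_on (B a) (($) t)"
        using isotonic_lse_minimal(1)[of "Y \<omega>"]
        by (auto simp: mono_on_def t_def B_def isotonic_cone_def)
    qed
    finally show ?thesis
      using isotonic_lse_oracle_inequality[OF \<theta>, of \<theta>star "\<epsilon> \<omega>"] by (simp add: assms(7) t_def)
  qed
  \<comment> \<open>\<open>integral_mono'\<close> asks for integrability of the upper bound only, so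
    measurability of the estimator is not at issue. The upper bound is non-negative because it
    dominates a square.\<close>
  have "expectation (\<lambda>\<omega>. (norm (isotonic_lse (Y \<omega>) - \<theta>star))\<^sup>2)
      \<le> expectation (\<lambda>\<omega>. (norm (\<theta>star - \<theta>))\<^sup>2 + (\<Sum>a\<in>?V. Z a \<omega>))"
    using int bound by (intro integral_mono') (auto intro: order_trans[OF zero_le_power2])
  also have "\<dots> = (norm (\<theta>star - \<theta>))\<^sup>2 + (\<Sum>a\<in>?V. expectation (Z a))"
    using int by (simp add: prob_space Bochner_Integration.integral_add)
  also have "(\<Sum>a\<in>?V. expectation (Z a)) \<le> 4 * \<sigma>\<^sup>2 * (\<Sum>a\<in>?V. 1 + ln (real (card (B a))))"
    unfolding sum_distrib_left by (intro sum_mono exp_Z)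
  \<comment> \<open>There are \<open>num_blocks \<theta>\<close> level sets and their sizes add up
    to the dimension, the two quantities in Jensen's bound.\<close>
  also have "(\<Sum>a\<in>?V. 1 + ln (real (card (B a)))) \<le> ?k * ln (exp 1 * ?n / ?k)"
    using sum_one_plus_ln_le[of ?V "\<lambda>a. card (B a)"]
    unfolding sum_card card_V by (auto simp: B_def card_gt_0_iff)
  finally have "expectation (\<lambda>\<omega>. (norm (isotonic_lse (Y \<omega>) - \<theta>star))\<^sup>2)
      \<le> (norm (\<theta>star - \<theta>))\<^sup>2 + 4 * \<sigma>\<^sup>2 * (?k * ln (exp 1 * ?n / ?k))"
    by (simp add: mult_left_mono)
  then have "risk (\<lambda>\<omega>. isotonic_lse (Y \<omega>)) \<theta>star
      \<le> 1 / ?n * ((norm (\<theta>star - \<theta>))\<^sup>2 + 4 * \<sigma>\<^sup>2 * (?k * ln (exp 1 * ?n / ?k)))"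
    unfolding risk_def by (intro mult_left_mono) auto
  then show "risk (\<lambda>\<omega>. isotonic_lse (Y \<omega>)) \<theta>star
     \<le> 1 / ?n * (norm (\<theta>star - \<theta>))\<^sup>2 + 4 * \<sigma>\<^sup>2 * ?k / ?n * ln (exp 1 * ?n / ?k)"
    by (simp add: add_divide_distrib mult.assoc)
qed

end
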